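(* Let $A\in R(m,n,k)$. Let $$\mu=\frac{k}{m-1}\left(\frac{mk}{n}-1\right).$$ Then $$\mathrm{Vol}(A)\le k\sqrt{\frac mn}\,(k-\mu)^{\frac{m-1}{2}}.$$
   Context: $R(m,n,k)$ denotes the set of $m\times n$ matrices with entries in $\{0,1\}$ each of whose rows sums to $k$. For a real $m\times n$ matrix $A$, where $m\le n$, $\mathrm{Vol}(A)=\sqrt{\det(AA^T)}$.
   Formalization: Assumes μ ≥ 0 (k = 0 or mk ≥ n), since the bound fails otherwise: for m=2, n=3, k=1 and rows (1,0,0), (0,1,0), Vol(A)=1 > √(8/9); whenever 0 < mk < n, rows with disjoint supports violate it. Also m ≥ 2, as μ is undefined for m = 1. *)

theory Defs
  imports Complex_Main "Jordan_Normal_Form.Determinant"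
begin

definition R :: "nat \<Rightarrow> nat \<Rightarrow> nat \<Rightarrow> real mat set" where
  "R m n k = {A \<in> carrier_mat m n.
     (\<forall>i<m. \<forall>j<n. A $$ (i, j) \<in> {0, 1}) \<and>
     (\<forall>i<m. (\<Sum>j<n. A $$ (i, j)) = real k)}"

text \<open>Only meaningful for matrices with at most as many rows as columns.\<close>

definition Vol :: "real mat \<Rightarrow> real" where
  "Vol A = sqrt (det (A * transpose_mat A))"

text \<open>
  Let \<open>\<mu> = k / (m - 1) * (m * k / n - 1)\<close>. The bound
  \<open>Vol A \<le> k * sqrt (m / n) * (k - \<mu>) powr ((m - 1) / 2)\<close> for \<open>A \<in> R m n k\<close>
  needs \<open>0 \<le> \<mu>\<close>, that is, \<open>k = 0\<close> or \<open>n \<le> m * k\<close>. Whenever \<open>0 < m * k < n\<close> and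
  \<open>2 \<le> m\<close> it is violated by any \<open>A\<close> whose rows have pairwise disjoint supports: there
  \<open>A * transpose_mat A\<close> is \<open>k\<close> times the identity, so the squared volume is \<open>k ^ m\<close>, while
  the square of the right-hand side is the product of \<open>m * k\<^sup>2 / n\<close>, which is not \<open>k\<close>, and
  \<open>m - 1\<close> copies of \<open>k - \<mu>\<close>; these \<open>m\<close> numbers have mean \<open>k\<close>, so by the strict
  inequality of arithmetic and geometric means their product is less than \<open>k ^ m\<close>. The
  smallest example is \<open>m = 2\<close>, \<open>n = 3\<close>, \<open>k = 1\<close>, where the volume is \<open>1\<close> and the
  right-hand side is \<open>sqrt (8 / 9)\<close>.
\<close>

end

theory Submission
  imports Defs "Jordan_Normal_Form.Schur_Decomposition" "HOL-Analysis.Convex"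
begin

text \<open>
  Write \<open>G = A A\<^sup>T\<close>, \<open>p = k - \<mu>\<close> and \<open>q = m k\<^sup>2 / n\<close>. The matrix
  \<open>T = p I + \<mu> J\<close>, where \<open>J\<close> is the all-ones matrix of order \<open>m\<close>, has the eigenvalue \<open>q\<close>
  on the all-ones vector and \<open>p\<close> on its orthogonal complement, so its determinant
  \<open>p\<^bsup>m-1\<^esup> q\<close> is the square of the claimed bound. It is the Gram matrix that \<open>A\<close> would have
  if any two distinct rows had inner product \<open>\<mu>\<close>. The claim is \<open>det G \<le> det T\<close>.

  If \<open>p > 0\<close>, let \<open>C\<close> be the positive square root of \<open>T\<^bsup>-1\<^esup>\<close>. The matrix \<open>C G C\<close> is again a
  Gram matrix, that of the rows of \<open>C A\<close>. Its eigenvalues are nonnegative, so by the inequality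
  of arithmetic and geometric means its determinant is at most the \<open>m\<close>-th power of its trace
  divided by \<open>m\<close> (lemma \<open>det_gram_le_mean_power\<close>). Since \<open>det (C G C) = det G / det T\<close>, it
  remains to see that the trace of \<open>C G C\<close> is at most \<open>m\<close>, which is its value for
  \<open>G = T\<close>. That trace depends on \<open>G\<close> only through the trace \<open>m k\<close> of \<open>G\<close>, the same as that of
  \<open>T\<close>, and through the sum of all entries of \<open>G\<close>. The dependence on the latter is nonincreasing
  because \<open>p \<le> q\<close>, which is what \<open>0 \<le> \<mu>\<close> means. Finally the sum of the entries of \<open>G\<close> is the
  sum of the squares of the column sums of \<open>A\<close>; these add up to \<open>m k\<close>, so by the Cauchy-Schwarz
  inequality the sum of squares is at least \<open>(m k)\<^sup>2 / n = m q\<close>, the sum of the entries of \<open>T\<close>.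

  If \<open>p = 0\<close>, all the rows of \<open>A\<close> are equal and both sides vanish.
\<close>

section \<open>Determinant and trace of a Gram matrix\<close>

lemma sum_diag_mult_commute:
  fixes A B :: "'a::comm_semiring_0 mat"
  assumes "A \<in> carrier_mat n c" and "B \<in> carrier_mat c n"
  shows "(\<Sum>i<n. (A * B) $$ (i, i)) = (\<Sum>j<c. (B * A) $$ (j, j))"
proof -
  have "(\<Sum>i<n. (A * B) $$ (i, i)) = (\<Sum>i<n. \<Sum>j<c. A $$ (i, j) * B $$ (j, i))"
    using assms by (intro sum.cong) (auto simp: scalar_prod_def atLeast0LessThan)
  also have "\<dots> = (\<Sum>j<c. \<Sum>i<n. B $$ (j, i) * A $$ (i, j))"
    by (subst sum.swap) (simp add: mult.commute)
  also have "\<dots> = (\<Sum>j<c. (B * A) $$ (j, j))"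
    using assms by (intro sum.cong) (auto simp: scalar_prod_def atLeast0LessThan)
  finally show ?thesis .
qed

lemma sum_diag_similar:
  fixes A B :: "'a::comm_semiring_1 mat"
  assumes A: "A \<in> carrier_mat n n" and sim: "similar_mat A B"
  shows "(\<Sum>i<n. A $$ (i, i)) = (\<Sum>i<n. B $$ (i, i))"
proof -
  from sim obtain P Q where "similar_mat_wit A B P Q"
    unfolding similar_mat_def by blast
  note w = similar_mat_witD2[OF A this]
  have "(\<Sum>i<n. A $$ (i, i)) = (\<Sum>i<n. (P * (B * Q)) $$ (i, i))"
    using w by (simp add: assoc_mult_mat[of P n n B n Q n])
  also have "\<dots> = (\<Sum>i<n. (B * Q * P) $$ (i, i))"
    using w by (intro sum_diag_mult_commute) auto
  also have "B * Q * P = B"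
    using w by (simp add: assoc_mult_mat[of B n n Q n P n])
  finally show ?thesis .
qed

text \<open>
  If \<open>v\<close> is an eigenvector of \<open>M M\<^sup>T\<close> for \<open>l\<close>, then \<open>l \<parallel>v\<parallel>\<^sup>2 = \<parallel>M\<^sup>T v\<parallel>\<^sup>2\<close>. The eigenvalue is
  taken over the complex numbers, where the characteristic polynomial splits; the order on
  complex numbers makes \<open>0 \<le> l\<close> include that \<open>l\<close> is real.
\<close>
lemma eigenvalue_gram_nonneg:
  fixes M :: "real mat" and l :: complex
  assumes M: "M \<in> carrier_mat n c"
    and ev: "eigenvalue (map_mat of_real (M * transpose_mat M)) l"
  shows "0 \<le> l"
proof -
  define N where "N = map_mat complex_of_real M"
  have N: "N \<in> carrier_mat n c" and NT: "transpose_mat N \<in> carrier_mat c n"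
    using M by (auto simp: N_def)
  have S: "map_mat of_real (M * transpose_mat M) = N * transpose_mat N"
    unfolding N_def using M
    by (subst of_real_hom.mat_hom_mult[of _ n c _ n])
       (auto intro!: arg_cong[where f = "\<lambda>X. _ * X"] eq_matI)
  from ev obtain v where "eigenvector (N * transpose_mat N) v l"
    unfolding eigenvalue_def S by blast
  with N have v: "v \<in> carrier_vec n" and v0: "v \<noteq> 0\<^sub>v n"
    and Sv: "(N * transpose_mat N) *\<^sub>v v = l \<cdot>\<^sub>v v"
    unfolding eigenvector_def by auto
  define w where "w = transpose_mat N *\<^sub>v v"
  have w: "w \<in> carrier_vec c" using NT v by (auto simp: w_def)
  have conj_w: "conjugate w = transpose_mat N *\<^sub>v conjugate v"
    using M v unfolding w_def N_def
    by (intro eq_vecI) (auto simp: scalar_prod_def sum_conjugate conjugate_complex_def)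
  have Nw: "N *\<^sub>v w = l \<cdot>\<^sub>v v"
    using Sv assoc_mult_mat_vec[OF N NT v] by (simp only: w_def)
  have "l * scalar_prod v (conjugate v) = scalar_prod (N *\<^sub>v w) (conjugate v)"
    unfolding Nw using v by simp
  also have "\<dots> = scalar_prod (conjugate v) (N *\<^sub>v w)"
    using N w v by (intro comm_scalar_prod[of _ n]) auto
  also have "\<dots> = scalar_prod (transpose_mat N *\<^sub>v conjugate v) w"
    using N w v by (intro transpose_vec_mult_scalar[symmetric]) auto
  also have "\<dots> = scalar_prod w (conjugate w)"
    unfolding conj_w[symmetric] using w by (intro comm_scalar_prod[of _ c]) auto
  finally have eq: "l * scalar_prod v (conjugate v) = scalar_prod w (conjugate w)" .
  have "0 < scalar_prod v (conjugate v)" using v v0 by simp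
  moreover have "0 \<le> scalar_prod w (conjugate w)" by (rule conjugate_square_ge_0_vec)
  ultimately show "0 \<le> l"
    unfolding eq[symmetric] by (simp add: less_complex_def less_eq_complex_def zero_le_mult_iff)
qed

text \<open>
  The inequality of arithmetic and geometric means for the eigenvalues. They are read off the
  diagonal of a triangular matrix similar to the Gram matrix.
\<close>
lemma det_gram_le_mean_power:
  fixes M :: "real mat"
  assumes M: "M \<in> carrier_mat n c" and "0 < n"
  shows "det (M * transpose_mat M) \<le> ((\<Sum>i<n. (M * transpose_mat M) $$ (i, i)) / real n) ^ n"
proof -
  define G where "G = M * transpose_mat M"
  have G: "G \<in> carrier_mat n n" using M by (auto simp: G_def)
  define S where "S = map_mat complex_of_real G"
  have S: "S \<in> carrier_mat n n" using G by (simp add: S_def)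
  obtain es where es: "char_poly S = (\<Prod>e\<leftarrow>es. [:- e, 1:])"
    using char_poly_factorized[OF S] by blast
  obtain B P Q where "schur_decomposition S es = (B, P, Q)"
    by (cases "schur_decomposition S es")
  from schur_decomposition[OF S es this] have sim: "similar_mat S B"
    and ut: "upper_triangular B" and diag: "diag_mat B = es"
    unfolding similar_mat_def by auto
  have B: "B \<in> carrier_mat n n"
    using S sim similar_matD[OF sim] by auto
  define d where "d i = Re (B $$ (i, i))" for i
  have d: "0 \<le> d i" "B $$ (i, i) = of_real (d i)" if "i < n" for i
  proof -
    have "B $$ (i, i) \<in> set es" using that B by (auto simp: diag[symmetric] diag_mat_def)
    then have "poly (char_poly S) (B $$ (i, i)) = 0"
      by (auto simp: es poly_prod_list prod_list_zero_iff)
    then have "eigenvalue S (B $$ (i, i))" by (simp add: eigenvalue_root_char_poly[OF S])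
    then have "0 \<le> B $$ (i, i)"
      using eigenvalue_gram_nonneg[OF M] by (simp add: S_def G_def)
    then show "0 \<le> d i" "B $$ (i, i) = of_real (d i)"
      by (auto simp: d_def less_eq_complex_def complex_eq_iff)
  qed
  have "complex_of_real (det G) = det S" by (simp add: S_def)
  also have "\<dots> = (\<Prod>i<n. B $$ (i, i))"
    using det_similar[OF sim] det_upper_triangular[OF ut B] B
    by (simp add: prod_list_diag_prod atLeast0LessThan)
  also have "\<dots> = of_real (\<Prod>i<n. d i)" using d by simp
  finally have det: "det G = (\<Prod>i<n. d i)" by (simp only: of_real_eq_iff)
  have "complex_of_real (\<Sum>i<n. G $$ (i, i)) = (\<Sum>i<n. S $$ (i, i))"
    using G by (simp add: S_def)
  also have "\<dots> = of_real (\<Sum>i<n. d i)" using sum_diag_similar[OF S sim] d by simp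
  finally have tr: "(\<Sum>i<n. G $$ (i, i)) = (\<Sum>i<n. d i)" by (simp only: of_real_eq_iff)
  have nonneg: "0 \<le> (\<Prod>i<n. d i)" using d by (intro prod_nonneg) auto
  have "(\<Prod>i<n. d i) powr (1 / real n) \<le> (\<Sum>i<n. d i) / real n"
    using arith_geom_mean[of "{..<n}" d] d \<open>0 < n\<close> by (auto simp: sum_divide_distrib)
  then have "((\<Prod>i<n. d i) powr (1 / real n)) ^ n \<le> ((\<Sum>i<n. d i) / real n) ^ n"
    by (intro power_mono) auto
  also have "((\<Prod>i<n. d i) powr (1 / real n)) ^ n = (\<Prod>i<n. d i)"
  proof -
    have "(x powr (1 / real n)) ^ n = x" if "0 \<le> x" for x
      using that \<open>0 < n\<close> by (cases "x = 0") (auto simp: powr_power)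
    with nonneg show ?thesis by blast
  qed
  finally show ?thesis using det tr by (simp add: G_def)
qed

section \<open>Comparison with a matrix that has two eigenvalues\<close>

text \<open>
  The all-ones vector is an eigenvector of \<open>a I + b J\<close>. Taking it as the first
  basis vector, and keeping the other unit vectors, makes the matrix triangular with diagonal
  \<open>a + n b, a, \<dots>, a\<close>. In the proof \<open>U\<close> is the change of basis.
\<close>
lemma det_scalar_plus_const:
  fixes a b :: "'a::idom"
  assumes "0 < n"
  shows "det (mat n n (\<lambda>(i, j). (if i = j then a else 0) + b)) = a ^ (n - 1) * (a + of_nat n * b)"
proof -
  define C where "C = mat n n (\<lambda>(i, j). (if i = j then a else 0) + b)"
  define U where "U = mat n n (\<lambda>(i, j). if i = j \<or> j = 0 then 1 else 0 :: 'a)"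
  define T where "T = mat n n (\<lambda>(i, j). if i = 0 then (if j = 0 then a + of_nat n * b else b)
      else if i = j then a else 0)"
  have carr: "C \<in> carrier_mat n n" "U \<in> carrier_mat n n" "T \<in> carrier_mat n n"
    by (auto simp: C_def U_def T_def)
  have sum_split: "(\<Sum>k<n. f k) = f 0 + (\<Sum>k\<in>{1..<n}. f k)" for f :: "nat \<Rightarrow> 'a"
    using sum.atLeast_Suc_lessThan[OF \<open>0 < n\<close>, of f] by (simp add: atLeast0LessThan)
  have "C * U = U * T"
  proof (rule eq_matI)
    fix i j assume "i < dim_row (U * T)" "j < dim_col (U * T)"
    then have ij: "i < n" "j < n" using carr by auto
    have "(C * U) $$ (i, j) = (\<Sum>k<n. ((if i = k then a else 0) + b) * (if k = j \<or> j = 0 then 1 else 0))"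
      using ij by (simp add: C_def U_def scalar_prod_def atLeast0LessThan)
    also have "\<dots> = (if j = 0 then a + of_nat n * b else (if i = j then a else 0) + b)"
    proof (cases "j = 0")
      case True
      then show ?thesis using ij by (simp add: sum.distrib)
    next
      case False
      then have "(\<Sum>k<n. ((if i = k then a else 0) + b) * (if k = j \<or> j = 0 then 1 else 0))
        = (\<Sum>k<n. if k = j then (if i = j then a else 0) + b else 0)"
        by (intro sum.cong) auto
      then show ?thesis using ij False by simp
    qed
    also have "\<dots> = (\<Sum>k<n. (if i = k \<or> k = 0 then 1 else 0) *
        (if k = 0 then (if j = 0 then a + of_nat n * b else b) else if k = j then a else 0))"
    proof -
      have "(\<Sum>k\<in>{1..<n}. (if i = k \<or> k = 0 then 1 else 0) *
        (if k = 0 then (if j = 0 then a + of_nat n * b else b) else if k = j then a else 0))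
        = (\<Sum>k\<in>{1..<n}. if k = i then (if i = j then a else 0) else 0)"
        by (rule sum.cong) auto
      also have "\<dots> = (if i = 0 then 0 else if i = j then a else 0)"
        using ij by (auto simp: sum.delta)
      finally show ?thesis by (subst sum_split) auto
    qed
    also have "\<dots> = (U * T) $$ (i, j)"
      using ij by (simp add: U_def T_def scalar_prod_def atLeast0LessThan)
    finally show "(C * U) $$ (i, j) = (U * T) $$ (i, j)" .
  qed (use carr in auto)
  then have "det C * det U = det U * det T"
    using carr by (metis det_mult)
  moreover have "det U = 1"
    by (subst det_lower_triangular[OF _ carr(2)])
       (auto simp: U_def prod_list_diag_prod intro!: prod.neutral)
  moreover have "det T = a ^ (n - 1) * (a + of_nat n * b)"
  proof -
    have "det T = (\<Prod>i = 0..<n. T $$ (i, i))"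
      by (subst det_upper_triangular[OF _ carr(3)])
         (auto simp: T_def prod_list_diag_prod intro!: upper_triangularI)
    also have "\<dots> = (\<Prod>i = 0..<n. if i = 0 then a + of_nat n * b else a)"
      by (rule prod.cong) (auto simp: T_def)
    also have "\<dots> = (a + of_nat n * b) * (\<Prod>i = Suc 0..<n. a)"
      using \<open>0 < n\<close> by (subst prod.atLeast_Suc_lessThan) auto
    finally show ?thesis by simp
  qed
  ultimately show ?thesis by (simp add: C_def)
qed

text \<open>
  The right-hand side is the determinant of the symmetric matrix \<open>T\<close> that acts as \<open>q\<close> on the
  all-ones vector and as \<open>p\<close> on its orthogonal complement. The left-hand side of the hypothesis
  \<open>trace\<close> is the trace of \<open>T\<^bsup>-1\<^esup> A A\<^sup>T\<close>, since \<open>T\<^bsup>-1\<^esup> = (1/p) I + ((1/q - 1/p) / m) J\<close>. The lemma is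
  the bound \<open>det_gram_le_mean_power\<close> for \<open>C A\<close>, with \<open>C\<close> the square root of \<open>T\<^bsup>-1\<^esup>\<close>.
\<close>
lemma det_gram_le_two_eigenvalues:
  fixes A :: "real mat" and p q :: real
  assumes A: "A \<in> carrier_mat m n" and "0 < m" and "0 < p" and "0 < q"
    and trace: "(\<Sum>j<n. \<Sum>i<m. (A $$ (i, j))\<^sup>2) / p
      + (1 / q - 1 / p) / real m * (\<Sum>j<n. (\<Sum>i<m. A $$ (i, j))\<^sup>2) \<le> real m"
  shows "det (A * transpose_mat A) \<le> p ^ (m - 1) * q"
proof -
  \<comment> \<open>\<open>a I + b J\<close> has the eigenvalues \<open>1 / sqrt q\<close> on the all-ones vector and
    \<open>1 / sqrt p\<close> on its complement, so it is the square root of \<open>T\<^bsup>-1\<^esup>\<close>.\<close>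
  define a where "a = 1 / sqrt p"
  define b where "b = (1 / sqrt q - 1 / sqrt p) / real m"
  have ab: "a + real m * b = 1 / sqrt q" using \<open>0 < m\<close> by (simp add: a_def b_def)
  have a2: "a\<^sup>2 = 1 / p" using \<open>0 < p\<close> by (simp add: a_def power_divide)
  have coeff: "2 * a * b + real m * b\<^sup>2 = (1 / q - 1 / p) / real m"
  proof -
    have "real m * (2 * a * b + real m * b\<^sup>2) = (a + real m * b)\<^sup>2 - a\<^sup>2"
      by (simp add: power2_eq_square algebra_simps)
    also have "\<dots> = 1 / q - 1 / p"
      unfolding ab a2 using \<open>0 < q\<close> by (simp add: power_divide)
    finally show ?thesis using \<open>0 < m\<close> by (simp add: field_simps)
  qed
  define C where "C = mat m m (\<lambda>(i, j). (if i = j then a else 0) + b)"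
  have C: "C \<in> carrier_mat m m" by (simp add: C_def)
  define s where "s j = (\<Sum>i<m. A $$ (i, j))" for j
  define M where "M = C * A"
  have M: "M \<in> carrier_mat m n" using A C by (simp add: M_def)
  have M_entry: "M $$ (i, j) = a * A $$ (i, j) + b * s j" if "i < m" "j < n" for i j
  proof -
    have "M $$ (i, j) = (\<Sum>l<m. ((if i = l then a else 0) + b) * A $$ (l, j))"
      using that A by (simp add: M_def C_def scalar_prod_def atLeast0LessThan)
    also have "\<dots> = (\<Sum>l<m. (if i = l then a * A $$ (l, j) else 0)) + (\<Sum>l<m. b * A $$ (l, j))"
      unfolding sum.distrib[symmetric] by (rule sum.cong) (auto simp: algebra_simps)
    finally show ?thesis using that by (simp add: s_def sum_distrib_left)
  qed
  have "(\<Sum>i<m. (M * transpose_mat M) $$ (i, i)) = (\<Sum>i<m. \<Sum>j<n. (M $$ (i, j))\<^sup>2)"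
    using M by (intro sum.cong) (auto simp: scalar_prod_def atLeast0LessThan power2_eq_square)
  also have "\<dots> = (\<Sum>j<n. \<Sum>i<m. (a * A $$ (i, j) + b * s j)\<^sup>2)"
    by (subst sum.swap) (simp add: M_entry)
  also have "\<dots> = (\<Sum>j<n. (\<Sum>i<m. (A $$ (i, j))\<^sup>2) / p + (1 / q - 1 / p) / real m * (s j)\<^sup>2)"
  proof (rule sum.cong)
    fix j
    have "(\<Sum>i<m. (a * A $$ (i, j) + b * s j)\<^sup>2)
        = (\<Sum>i<m. a\<^sup>2 * (A $$ (i, j))\<^sup>2 + 2 * a * b * s j * A $$ (i, j) + b\<^sup>2 * (s j)\<^sup>2)"
      by (rule sum.cong) (simp_all add: power2_eq_square algebra_simps)
    also have "\<dots> = a\<^sup>2 * (\<Sum>i<m. (A $$ (i, j))\<^sup>2) + 2 * a * b * s j * s j + real m * (b\<^sup>2 * (s j)\<^sup>2)"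
      by (simp add: sum.distrib sum_distrib_left s_def)
    also have "\<dots> = a\<^sup>2 * (\<Sum>i<m. (A $$ (i, j))\<^sup>2) + (2 * a * b + real m * b\<^sup>2) * (s j)\<^sup>2"
      by (simp add: power2_eq_square algebra_simps)
    finally show "(\<Sum>i<m. (a * A $$ (i, j) + b * s j)\<^sup>2)
        = (\<Sum>i<m. (A $$ (i, j))\<^sup>2) / p + (1 / q - 1 / p) / real m * (s j)\<^sup>2"
      unfolding coeff a2 by simp
  qed simp
  also have "\<dots> \<le> real m"
    using trace by (simp add: sum.distrib sum_distrib_left sum_divide_distrib s_def)
  finally have tr: "(\<Sum>i<m. (M * transpose_mat M) $$ (i, i)) \<le> real m" .
  have tr0: "0 \<le> (\<Sum>i<m. (M * transpose_mat M) $$ (i, i))"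
    using M by (intro sum_nonneg) (auto simp: scalar_prod_def intro!: sum_nonneg)
  have "det (M * transpose_mat M) \<le> ((\<Sum>i<m. (M * transpose_mat M) $$ (i, i)) / real m) ^ m"
    by (rule det_gram_le_mean_power[OF M \<open>0 < m\<close>])
  also have "\<dots> \<le> 1" using tr tr0 \<open>0 < m\<close> by (intro power_le_one) auto
  finally have le1: "det (M * transpose_mat M) \<le> 1" .
  have "M * transpose_mat M = C * ((A * transpose_mat A) * transpose_mat C)"
    using A C unfolding M_def
    by (simp add: transpose_mult[OF C A] assoc_mult_mat[of C m m A n _ m]
        assoc_mult_mat[of A m n "transpose_mat A" m "transpose_mat C" m])
  then have "det (M * transpose_mat M) = det C * (det (A * transpose_mat A) * det (transpose_mat C))"
    using A C det_mult[of C m "A * transpose_mat A * transpose_mat C"]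
      det_mult[of "A * transpose_mat A" m "transpose_mat C"]
      mult_carrier_mat[of "A * transpose_mat A" m m "transpose_mat C" m]
    by (simp del: assoc_mult_mat)
  also have "\<dots> = (det C)\<^sup>2 * det (A * transpose_mat A)"
    using C by (simp add: det_transpose power2_eq_square)
  also have "(det C)\<^sup>2 = (a\<^sup>2) ^ (m - 1) * (a + real m * b)\<^sup>2"
    unfolding C_def det_scalar_plus_const[OF \<open>0 < m\<close>]
    by (simp add: power_mult_distrib power_mult[symmetric] mult.commute)
  also have "\<dots> = 1 / (p ^ (m - 1) * q)"
    unfolding ab a2 using \<open>0 < q\<close> by (simp add: power_divide)
  finally have "det (A * transpose_mat A) / (p ^ (m - 1) * q) \<le> 1" using le1 by simp
  moreover have "0 < p ^ (m - 1) * q" using \<open>0 < p\<close> \<open>0 < q\<close> by simp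
  ultimately show ?thesis by (simp only: pos_divide_le_eq mult_1)
qed

section \<open>The volume bound\<close>

theorem theorem6p2:
  fixes m n k :: nat and A :: "real mat" and \<mu> :: real
  assumes "2 \<le> m" and "m \<le> n"
    and "A \<in> R m n k"
    and "\<mu> = real k / (real m - 1) * (real m * real k / real n - 1)"
    and "0 \<le> \<mu>"
  shows "Vol A \<le> real k * sqrt (real m / real n) * (real k - \<mu>) powr ((real m - 1) / 2)"
proof -
  define p where "p = real k - \<mu>"
  define q where "q = real m * (real k)\<^sup>2 / real n"
  have m1: "0 < real m - 1" and "0 < m" and "0 < n" using assms(1,2) by auto
  have A: "A \<in> carrier_mat m n"
    and bin: "\<And>i j. i < m \<Longrightarrow> j < n \<Longrightarrow> A $$ (i, j) \<in> {0, 1}"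
    and rowsum: "\<And>i. i < m \<Longrightarrow> (\<Sum>j<n. A $$ (i, j)) = real k"
    using assms(3) by (auto simp: R_def)
  have "(\<Sum>j<n. A $$ (0, j)) \<le> (\<Sum>j<n. 1)"
    using bin \<open>0 < m\<close> by (intro sum_mono) fastforce
  then have kn: "k \<le> n" using rowsum \<open>0 < m\<close> by simp
  have "(real m - 1) * \<mu> = real k * (real m * real k / real n - 1)"
    using m1 unfolding assms(4) by simp
  then have mu: "(real m - 1) * \<mu> = q - real k"
    by (simp add: q_def power2_eq_square algebra_simps)
  have p: "(real m - 1) * p = real m * real k - q"
    using mu by (simp add: p_def algebra_simps)
  have p_alt: "(real m - 1) * p = real m * real k * (1 - real k / real n)"
    unfolding p q_def by (simp add: power2_eq_square algebra_simps)
  have "0 \<le> (real m - 1) * p" unfolding p_alt using kn \<open>0 < n\<close> by simp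
  then have "0 \<le> p" using m1 by (simp add: zero_le_mult_iff)
  show ?thesis
  proof (cases "p = 0")
    case True
    \<comment> \<open>The matrix \<open>T\<close> is singular here, but \<open>A\<close> is then all zeros or all ones.\<close>
    then have "k = 0 \<or> k = n" using p_alt \<open>0 < m\<close> \<open>0 < n\<close> by auto
    then have "A $$ (i, j) = (if k = 0 then 0 else 1)" if "i < m" "j < n" for i j
    proof
      assume "k = 0"
      then have "(\<Sum>j<n. A $$ (i, j)) = 0" using rowsum that by simp
      then have "\<forall>j\<in>{..<n}. A $$ (i, j) = 0"
        using bin that by (subst (asm) sum_nonneg_eq_0_iff) fastforce+
      then show ?thesis using \<open>k = 0\<close> that by simp
    next
      assume "k = n"
      then have "(\<Sum>j<n. 1 - A $$ (i, j)) = 0" using rowsum that by (simp add: sum_subtractf)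
      then have "\<forall>j\<in>{..<n}. 1 - A $$ (i, j) = 0"
        using bin that by (subst (asm) sum_nonneg_eq_0_iff) fastforce+
      then show ?thesis using \<open>k = n\<close> \<open>0 < n\<close> that by simp
    qed
    then have "row A 0 = row A 1" using A assms(1) by (intro eq_vecI) auto
    then have "row (A * transpose_mat A) 0 = row (A * transpose_mat A) 1"
      using A assms(1) by (intro eq_vecI) auto
    then have "det (A * transpose_mat A) = 0"
      using A assms(1) by (intro det_identical_rows[of _ m 0 1]) auto
    then show ?thesis by (simp add: Vol_def)
  next
    case False
    with \<open>0 \<le> p\<close> have "0 < p" by simp
    have "k \<noteq> 0"
    proof
      assume "k = 0"
      then have "(real m - 1) * p = 0" using p by (simp add: q_def)
      then show False using m1 \<open>0 < p\<close> by simp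
    qed
    then have "0 < q" using \<open>0 < m\<close> \<open>0 < n\<close> by (simp add: q_def)
    have "0 \<le> (real m - 1) * \<mu>" using m1 assms(5) by simp
    then have "p \<le> q" using mu assms(5) by (simp add: p_def)
    define \<sigma> where "\<sigma> = (\<Sum>j<n. (\<Sum>i<m. A $$ (i, j))\<^sup>2)"
    have total: "(\<Sum>j<n. \<Sum>i<m. A $$ (i, j)) = real m * real k"
      by (subst sum.swap) (simp add: rowsum)
    have "(\<Sum>j<n. \<Sum>i<m. (A $$ (i, j))\<^sup>2) = (\<Sum>j<n. \<Sum>i<m. A $$ (i, j))"
      using bin by (intro sum.cong) fastforce+
    then have squares: "(\<Sum>j<n. \<Sum>i<m. (A $$ (i, j))\<^sup>2) = real m * real k" using total by simp
    have "(real m * real k)\<^sup>2 \<le> \<sigma> * real n"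
      using sum_squared_le_sum_of_squares[of "\<lambda>j. \<Sum>i<m. A $$ (i, j)" "{..<n}"]
      by (simp add: total \<sigma>_def)
    then have \<sigma>: "real m * q \<le> \<sigma>"
      using \<open>0 < n\<close> by (simp add: q_def field_simps power2_eq_square)
    have "1 / q \<le> 1 / p" using \<open>0 < p\<close> \<open>p \<le> q\<close> by (simp add: frac_le)
    then have "(1 / q - 1 / p) / real m * \<sigma> \<le> (1 / q - 1 / p) / real m * (real m * q)"
      using \<sigma> by (intro mult_left_mono_neg) (auto simp: divide_nonpos_nonneg)
    also have "\<dots> = 1 - q / p" using \<open>0 < m\<close> \<open>0 < q\<close> by (simp add: field_simps)
    finally have "real m * real k / p + (1 / q - 1 / p) / real m * \<sigma>
        \<le> (real m * real k - q) / p + 1"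
      by (simp add: diff_divide_distrib)
    also have "\<dots> = real m" unfolding p[symmetric] using \<open>0 < p\<close> by simp
    finally have "det (A * transpose_mat A) \<le> p ^ (m - 1) * q"
      using A \<open>0 < m\<close> \<open>0 < p\<close> \<open>0 < q\<close>
      by (intro det_gram_le_two_eigenvalues) (auto simp: squares \<sigma>_def)
    then have "Vol A \<le> sqrt (p ^ (m - 1) * q)" unfolding Vol_def by simp
    also have "\<dots> = sqrt q * sqrt (p ^ (m - 1))" by (simp add: real_sqrt_mult mult.commute)
    also have "sqrt q = real k * sqrt (real m / real n)"
      by (simp add: q_def real_sqrt_mult real_sqrt_divide)
    also have "sqrt (p ^ (m - 1)) = p powr ((real m - 1) / 2)"
      using \<open>0 < p\<close> \<open>0 < m\<close>
      by (simp add: powr_half_sqrt[symmetric] powr_realpow[symmetric] powr_powr of_nat_diff)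
    finally show ?thesis by (simp add: p_def)
  qed
qed

end
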